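(* Let $(\Omega,\mathcal{F},\mathbb{P})$ be a probability space, $\mathcal{F}_0\subset\mathcal{F}$ a sub-sigma-algebra, $(S,d)$ a separable metric space, $(Y_n)_n$ a sequence of random elements of $S$ defined on $(\Omega,\mathcal{F},\mathbb{P})$, and $Y$ a random element of $S$ defined on a probability space $(\Omega',\mathcal{F}',\mathbb{P}')$. Assume that $E_0=E[\,\cdot\,|\mathcal{F}_0]$ is regular with decomposition $\{\mathbb{P}_\omega\}_{\omega\in\Omega}$. If $Y_n$ converges to $Y$ in the quenched sense with respect to $\mathcal{F}_0$, there exists a set $\Omega_0\subset\Omega$ with $\mathbb{P}\Omega_0=1$ such that for all bounded continuous $f:S\to\mathbb{R}$ and all $\omega\in\Omega_0$, $$\int_\Omega f\circ Y_n(z)\,d\mathbb{P}_\omega(z)\to_n\int_{\Omega'}f\circ Y(z)\,d\mathbb{P}'(z).$$ In particular, $Y_n$ converges to $Y$ in the quenched sense with respect to $\mathcal{F}_0$ if and only if for $\mathbb{P}$-a.e. $\omega$, $Y_n\Rightarrow Y$ with respect to $\mathbb{P}_\omega$.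
   Context: Random elements of $S$ are $S$-valued functions measurable with respect to the Borel sigma-algebra of $S$. $\Rightarrow$ denotes convergence in distribution. Regular: $E_0$ is regular if there is a family $\{\mathbb{P}_\omega\}_{\omega\in\Omega}$ of probability measures on $(\Omega,\mathcal{F})$, called a decomposition of $E_0$, such that for every $\mathbb{P}$-integrable $X:\Omega\to\mathbb{R}$ the function $\omega\mapsto\int X\,d\mathbb{P}_\omega$ (set to $0$ where the integral makes no sense) is an $\mathcal{F}_0$-measurable version of $E_0X$. Quenched convergence: $Y_n$ converges to $Y$ in the quenched sense with respect to $\mathcal{F}_0$ if for every bounded continuous $f:S\to\mathbb{R}$, $E[f(Y_n)|\mathcal{F}_0]\to Ef(Y)$ $\mathbb{P}$-a.s. as $n\to\infty$ (the exceptional null set may depend on $f$). *)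

theory Defs
  imports "HOL-Probability.Probability"
begin

definition bdd_cont :: "('s::metric_space \<Rightarrow> real) \<Rightarrow> bool" where
  "bdd_cont f \<longleftrightarrow> continuous_on UNIV f \<and> bounded (range f)"

text \<open>
  \<open>E\<^sub>0 = E[ \<cdot> | F0]\<close> is regular with decomposition \<open>P\<close>. Only the values \<open>P \<omega>\<close> with
  \<open>\<omega> \<in> space M\<close> matter. The Bochner integral is \<open>0\<close> on non-integrable functions, which is the
  convention wanted where the integral makes no sense.
\<close>

definition decomposition :: "'a measure \<Rightarrow> 'a measure \<Rightarrow> ('a \<Rightarrow> 'a measure) \<Rightarrow> bool" where
  "decomposition M F0 P \<longleftrightarrow>
     (\<forall>\<omega>\<in>space M. prob_space (P \<omega>) \<and> sets (P \<omega>) = sets M) \<and>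
     (\<forall>X :: 'a \<Rightarrow> real. integrable M X \<longrightarrow>
        (\<lambda>\<omega>. LINT z|P \<omega>. X z) \<in> borel_measurable F0 \<and>
        (AE \<omega> in M. (LINT z|P \<omega>. X z) = real_cond_exp M F0 X \<omega>))"

text \<open>
  \<open>Y n\<close> lives on \<open>M\<close> and the limit \<open>Y'\<close> on a possibly different space \<open>M'\<close>.
  The exceptional null set may depend on \<open>f\<close>.
\<close>

definition quenched_conv ::
  "'a measure \<Rightarrow> 'a measure \<Rightarrow> (nat \<Rightarrow> 'a \<Rightarrow> 's::metric_space) \<Rightarrow> 'b measure \<Rightarrow> ('b \<Rightarrow> 's) \<Rightarrow> bool" where
  "quenched_conv M F0 Y M' Y' \<longleftrightarrow>
     (\<forall>f. bdd_cont f \<longrightarrow>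
        (AE \<omega> in M. (\<lambda>n. real_cond_exp M F0 (\<lambda>z. f (Y n z)) \<omega>)
                       \<longlonglongrightarrow> (LINT z|M'. f (Y' z))))"

text \<open>
  Convergence in distribution in a general metric space; the library's \<open>weak_conv_m\<close> only
  covers measures on the real line.
\<close>

definition conv_in_distr ::
  "'a measure \<Rightarrow> (nat \<Rightarrow> 'a \<Rightarrow> 's::metric_space) \<Rightarrow> 'b measure \<Rightarrow> ('b \<Rightarrow> 's) \<Rightarrow> bool" where
  "conv_in_distr Q Y M' Y' \<longleftrightarrow>
     (\<forall>f. bdd_cont f \<longrightarrow> (\<lambda>n. LINT z|Q. f (Y n z)) \<longlonglongrightarrow> (LINT z|M'. f (Y' z)))"

end

theory Submission
  imports Defs
begin

text \<open>
  The difficulty is that quenched convergence allows an exceptional null set for each of the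
  uncountably many bounded continuous test functions, whereas one null set is wanted for all of
  them.  On a separable metric space countably many test functions suffice: with \<open>x\<close> in a
  countable dense set, \<open>q\<close> rational and \<open>r\<close> a natural number, the spikes
  \<open>y \<mapsto> max 0 (q - r * dist x y)\<close> that lie below a continuous \<open>f \<ge> 0\<close> have pointwise
  supremum \<open>f\<close>, because a steep spike of height just below \<open>f y\<close>, with apex close to \<open>y\<close>,
  vanishes before \<open>f\<close> can drop (\<open>spike_approx\<close>).  Finite maxima of spikes form a countable family,
  and dominated convergence yields members \<open>g \<le> f\<close> of it with \<open>\<integral>g\<close> as close to \<open>\<integral>f\<close> as desired.

  If the integrals of every such \<open>g\<close> converge, then the inequality \<open>g \<le> f\<close> bounds the integrals
  of \<open>f\<close> from below in the limit (\<open>eventually_integral_lower_bound\<close>).  Adding a constant to \<open>f\<close>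
  and to \<open>- f\<close> makes both nonnegative, which turns this one-sided bound into convergence
  (\<open>countable_convergence_determining\<close>).  For the laws of \<open>Y n\<close> under
  \<open>P \<omega>\<close>, countably many null sets remain: one for each \<open>g\<close>, from quenched convergence, and one for
  each pair \<open>(g, n)\<close>, outside of which \<open>\<integral>g \<circ> Y n\<close> under \<open>P \<omega>\<close> is the conditional expectation.
\<close>

section \<open>Spikes and their finite maxima\<close>

fun spike :: "'s::metric_space \<times> real \<times> nat \<Rightarrow> 's \<Rightarrow> real" where
  "spike (x, q, r) y = max 0 (q - real r * dist x y)"

text \<open>
  Indexing the maxima by lists makes their countability immediate, and the empty maximum is \<open>0\<close>, in
  accordance with the nonnegativity of spikes.
\<close>

primrec spike_max :: "('s::metric_space \<times> real \<times> nat) list \<Rightarrow> 's \<Rightarrow> real" where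
  "spike_max [] y = 0"
| "spike_max (p # ps) y = max (spike p y) (spike_max ps y)"

lemma spike_le_height: "spike p y \<le> max 0 (fst (snd p))"
proof -
  obtain x q r where p: "p = (x, q, r)"
    by (cases p)
  have "0 \<le> real r * dist x y"
    by simp
  then show ?thesis
    by (simp only: p spike.simps fst_conv snd_conv)
qed

lemma continuous_spike: "continuous_on UNIV (spike p)"
proof -
  obtain x q r where p: "p = (x, q, r)"
    by (cases p)
  have "spike p = (\<lambda>y. max 0 (q - real r * dist x y))"
    by (auto simp: p)
  then show ?thesis
    by (auto intro!: continuous_intros)
qed

lemma spike_max_nonneg: "0 \<le> spike_max ps y"
  by (induction ps) (auto simp: le_max_iff_disj)

lemma spike_le_spike_max: "p \<in> set ps \<Longrightarrow> spike p y \<le> spike_max ps y"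
  by (induction ps) (auto simp: le_max_iff_disj)

lemma spike_max_le:
  assumes "0 \<le> c" and "\<And>p. p \<in> set ps \<Longrightarrow> spike p y \<le> c"
  shows "spike_max ps y \<le> c"
  using assms by (induction ps) auto

lemma bdd_cont_spike_max: "bdd_cont (spike_max ps)"
proof -
  have "continuous_on UNIV (spike_max ps)"
  proof (induction ps)
    case (Cons p ps)
    have "spike_max (p # ps) = (\<lambda>y. max (spike p y) (spike_max ps y))"
      by auto
    with Cons continuous_spike[of p] show ?case
      by (auto intro!: continuous_on_max)
  qed (simp add: continuous_on_const)
  moreover obtain B where "\<And>y. spike_max ps y \<le> B"
  proof (induction ps arbitrary: thesis)
    case (Cons p ps)
    then obtain B where "\<And>y. spike_max ps y \<le> B"
      by blast
    then have "spike_max (p # ps) y \<le> max (max 0 (fst (snd p))) B" for y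
      using spike_le_height[of p y] by (metis spike_max.simps(2) max.mono)
    then show ?case
      using Cons.prems by blast
  qed auto
  ultimately show ?thesis
    unfolding bdd_cont_def bounded_iff real_norm_def using spike_max_nonneg[of ps]
    by (auto simp: abs_of_nonneg)
qed

section \<open>Approximation from below\<close>

text \<open>
  The apex \<open>x\<close> and the slope \<open>r\<close> are chosen so that the support of the spike, a ball of radius
  \<open>q / r\<close> around \<open>x\<close>, stays inside a ball around \<open>y\<close> on which \<open>f\<close> exceeds the height \<open>q\<close>, while
  \<open>x\<close> is so close to \<open>y\<close> that little height is lost between them.
\<close>

lemma spike_approx:
  fixes f :: "'s::metric_space \<Rightarrow> real"
  assumes dense: "closure D = UNIV" and f: "continuous_on UNIV f" "\<And>z. 0 \<le> f z" and e: "0 < e"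
  obtains x q r where "x \<in> D" "q \<in> \<rat>" "\<And>z. spike (x, q, r) z \<le> f z" "f y - e < spike (x, q, r) y"
proof -
  obtain q where q: "q \<in> \<rat>" "f y - e / 2 < q" "q < f y"
    using Rats_dense_in_real[of "f y - e / 2" "f y"] e by auto
  have "isCont f y"
    using f(1) by (simp add: continuous_on_eq_continuous_at)
  then obtain d where d: "0 < d" "\<And>z. dist z y < d \<Longrightarrow> dist (f z) (f y) < f y - q"
    using q(3) unfolding continuous_at_eps_delta by (metis diff_gt_0_iff_gt)
  obtain r :: nat where r: "2 * \<bar>q\<bar> / d < real r"
    using reals_Archimedean2 by blast
  then have r0: "0 < real r"
    using d(1) by (smt (verit) divide_nonneg_pos)
  \<comment> \<open>Within \<open>e / (2 * r)\<close> of the apex the spike loses less than \<open>e / 2\<close> of its height.\<close>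
  have "0 < min (d / 2) (e / (2 * real r))"
    using d(1) e r0 by simp
  then obtain x where x: "x \<in> D" "dist x y < min (d / 2) (e / (2 * real r))"
    using dense by (metis UNIV_I closure_approachable)
  have "spike (x, q, r) z \<le> f z" for z
  proof (cases "dist z y < d")
    case True
    then have "q \<le> f z"
      using d(2)[of z] by (auto simp: dist_real_def)
    moreover have "0 \<le> real r * dist x z"
      by simp
    ultimately show ?thesis
      using f(2)[of z] unfolding spike.simps by linarith
  next
    case False
    then have "d / 2 \<le> dist x z"
      using x(2) dist_triangle[of z y x] by (simp add: dist_commute)
    then have "real r * (d / 2) \<le> real r * dist x z"
      using r0 by simp
    moreover have "\<bar>q\<bar> < real r * (d / 2)"
      using r d(1) by (simp add: field_simps)
    ultimately show ?thesis
      using f(2)[of z] unfolding spike.simps by linarith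
  qed
  moreover have "f y - e < spike (x, q, r) y"
  proof -
    have "real r * dist x y < e / 2"
      using x(2) r0 by (simp add: field_simps)
    with q(2) show ?thesis
      unfolding spike.simps by linarith
  qed
  ultimately show ?thesis
    using that x(1) q(1) by blast
qed

lemma bdd_cont_measurable: "bdd_cont f \<Longrightarrow> f \<in> borel_measurable borel"
  by (simp add: bdd_cont_def borel_measurable_continuous_onI)

lemma bdd_cont_integrable:
  assumes "prob_space \<mu>" and "sets \<mu> = sets borel" and "bdd_cont f"
  shows "integrable \<mu> f"
proof -
  interpret prob_space \<mu> by fact
  obtain B where "\<And>x. norm (f x) \<le> B"
    using assms(3) by (auto simp: bdd_cont_def bounded_iff)
  moreover have "f \<in> borel_measurable \<mu>"
    using bdd_cont_measurable[OF assms(3)] measurable_cong_sets[OF assms(2) refl] by blast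
  ultimately show ?thesis
    by (intro integrable_const_bound[of f B]) auto
qed

definition spike_family :: "'s::metric_space set \<Rightarrow> ('s \<Rightarrow> real) set" where
  "spike_family D = spike_max ` lists (D \<times> \<rat> \<times> UNIV)"

lemma countable_spike_family: "countable D \<Longrightarrow> countable (spike_family D)"
  by (simp add: spike_family_def countable_rat)

lemma bdd_cont_spike_family: "g \<in> spike_family D \<Longrightarrow> bdd_cont g"
  by (auto simp: spike_family_def bdd_cont_spike_max)

text \<open>
  The spikes below \<open>f\<close> with parameters in \<open>D \<times> \<rat> \<times> \<nat>\<close> are countably many, so the maxima of
  the initial segments of an enumeration form a sequence, as dominated convergence requires.
\<close>

lemma spike_family_integral_approx:
  fixes f :: "'s::metric_space \<Rightarrow> real"
  assumes D: "countable D" "closure D = UNIV"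
    and \<nu>: "prob_space \<nu>" "sets \<nu> = sets borel"
    and f: "bdd_cont f" "\<And>z. 0 \<le> f z" and e: "0 < e"
  obtains g where "g \<in> spike_family D" "\<And>z. g z \<le> f z" "(LINT z|\<nu>. f z) - e < (LINT z|\<nu>. g z)"
proof -
  define A where "A = {p \<in> D \<times> \<rat> \<times> UNIV. \<forall>z. spike p z \<le> f z}"
  have cont: "continuous_on UNIV f"
    using f(1) by (simp add: bdd_cont_def)
  have approx: "\<exists>p\<in>A. f y - \<epsilon> < spike p y" if "0 < \<epsilon>" for y \<epsilon>
  proof -
    obtain x q r where "x \<in> D" "q \<in> \<rat>" "\<And>z. spike (x, q, r) z \<le> f z" "f y - \<epsilon> < spike (x, q, r) y"
      using spike_approx[OF D(2) cont f(2) \<open>0 < \<epsilon>\<close>] by blast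
    then show ?thesis
      unfolding A_def by (intro bexI[of _ "(x, q, r)"]) (simp_all del: spike.simps)
  qed
  have "countable A"
    unfolding A_def
    by (rule countable_subset[of _ "D \<times> \<rat> \<times> UNIV"]) (auto simp: D(1) countable_rat)
  moreover have "A \<noteq> {}"
    using approx[of 1 undefined] by auto
  ultimately obtain enum :: "nat \<Rightarrow> _" where enum: "range enum = A"
    by (metis range_from_nat_into)
  define g where "g k = spike_max (map enum [0..<k])" for k
  have g_le: "g k z \<le> f z" for k z
    unfolding g_def using enum f(2) by (intro spike_max_le) (auto simp: A_def)
  have g_lim: "(\<lambda>k. g k z) \<longlonglongrightarrow> f z" for z
  proof (rule LIMSEQ_I)
    fix \<epsilon> :: real
    assume "0 < \<epsilon>"
    then obtain i where i: "f z - \<epsilon> < spike (enum i) z"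
      using approx[of \<epsilon> z] enum by blast
    have "norm (g k z - f z) < \<epsilon>" if "Suc i \<le> k" for k
    proof -
      have "spike (enum i) z \<le> g k z"
        unfolding g_def using that by (intro spike_le_spike_max) auto
      with i g_le[of k z] show ?thesis
        by simp
    qed
    then show "\<exists>k0. \<forall>k\<ge>k0. norm (g k z - f z) < \<epsilon>"
      by blast
  qed
  have g_in: "g k \<in> spike_family D" for k
  proof -
    have "enum i \<in> D \<times> \<rat> \<times> UNIV" for i
      using enum unfolding A_def by blast
    then show ?thesis
      unfolding g_def spike_family_def by (intro imageI) (simp add: in_lists_conv_set image_subset_iff)
  qed
  have "(\<lambda>k. LINT z|\<nu>. g k z) \<longlonglongrightarrow> (LINT z|\<nu>. f z)"
  proof (rule integral_dominated_convergence[where w = f])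
    show "f \<in> borel_measurable \<nu>" "integrable \<nu> f"
      using bdd_cont_integrable[OF \<nu> f(1)] by auto
    show "g k \<in> borel_measurable \<nu>" for k
      using bdd_cont_integrable[OF \<nu> bdd_cont_spike_family[OF g_in]] by auto
    show "AE z in \<nu>. (\<lambda>k. g k z) \<longlonglongrightarrow> f z"
      using g_lim by simp
    show "AE z in \<nu>. norm (g k z) \<le> f z" for k
      using g_le[of k] spike_max_nonneg[of "map enum [0..<k]"] unfolding g_def by (intro AE_I2) simp
  qed
  then have "eventually (\<lambda>k. (LINT z|\<nu>. f z) - e < (LINT z|\<nu>. g k z)) sequentially"
    using e by (intro order_tendstoD(1)) auto
  then obtain k where "(LINT z|\<nu>. f z) - e < (LINT z|\<nu>. g k z)"
    by (auto simp: eventually_sequentially)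
  with g_in g_le show ?thesis
    using that by blast
qed

section \<open>Convergence determined by spikes\<close>

lemma eventually_integral_lower_bound:
  fixes f :: "'s::metric_space \<Rightarrow> real"
  assumes D: "countable D" "closure D = UNIV"
    and \<mu>: "\<And>n. prob_space (\<mu> n)" "\<And>n. sets (\<mu> n) = sets borel"
    and \<nu>: "prob_space \<nu>" "sets \<nu> = sets borel"
    and conv: "\<And>g. g \<in> spike_family D \<Longrightarrow> (\<lambda>n. LINT z|\<mu> n. g z) \<longlonglongrightarrow> (LINT z|\<nu>. g z)"
    and f: "bdd_cont f" "\<And>z. 0 \<le> f z" and e: "0 < e"
  shows "\<forall>\<^sub>F n in sequentially. (LINT z|\<nu>. f z) - e < (LINT z|\<mu> n. f z)"
proof -
  obtain g where g: "g \<in> spike_family D" "\<And>z. g z \<le> f z" "(LINT z|\<nu>. f z) - e < (LINT z|\<nu>. g z)"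
    using spike_family_integral_approx[OF D \<nu> f e] by blast
  have le: "(LINT z|\<mu> n. g z) \<le> (LINT z|\<mu> n. f z)" for n
    using \<mu> f(1) bdd_cont_spike_family[OF g(1)] g(2)
    by (intro integral_mono bdd_cont_integrable) auto
  have "\<forall>\<^sub>F n in sequentially. (LINT z|\<nu>. f z) - e < (LINT z|\<mu> n. g z)"
    using order_tendstoD(1)[OF conv[OF g(1)] g(3)] .
  then show ?thesis
    by eventually_elim (use le in \<open>auto intro: less_le_trans\<close>)
qed

text \<open>
  The lower bound applies to \<open>B + f\<close> and to \<open>B - f\<close> when \<open>\<bar>f\<bar> \<le> B\<close>; as all the measures have
  total mass \<open>1\<close>, the constant cancels, and the second bound is an upper bound for \<open>f\<close>.
\<close>

lemma countable_convergence_determining: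
  fixes f :: "'s::metric_space \<Rightarrow> real"
  assumes D: "countable D" "closure D = UNIV"
    and \<mu>: "\<And>n. prob_space (\<mu> n)" "\<And>n. sets (\<mu> n) = sets borel"
    and \<nu>: "prob_space \<nu>" "sets \<nu> = sets borel"
    and conv: "\<And>g. g \<in> spike_family D \<Longrightarrow> (\<lambda>n. LINT z|\<mu> n. g z) \<longlonglongrightarrow> (LINT z|\<nu>. g z)"
    and f: "bdd_cont f"
  shows "(\<lambda>n. LINT z|\<mu> n. f z) \<longlonglongrightarrow> (LINT z|\<nu>. f z)"
proof -
  obtain B where B: "\<And>z. \<bar>f z\<bar> \<le> B"
    using f by (auto simp: bdd_cont_def bounded_iff)
  have bc: "bdd_cont (\<lambda>z. B + f z)" "bdd_cont (\<lambda>z. B - f z)"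
  proof -
    have "\<bar>B + f z\<bar> \<le> 2 * B" "\<bar>B - f z\<bar> \<le> 2 * B" for z
      using B[of z] by auto
    then have "bounded (range (\<lambda>z. B + f z))" "bounded (range (\<lambda>z. B - f z))"
      unfolding bounded_iff real_norm_def by blast+
    with f show "bdd_cont (\<lambda>z. B + f z)" "bdd_cont (\<lambda>z. B - f z)"
      by (auto simp: bdd_cont_def intro!: continuous_intros)
  qed
  have nonneg: "0 \<le> B + f z" "0 \<le> B - f z" for z
    using B[of z] by auto
  have shift: "(LINT z|Q. B + f z) = B + (LINT z|Q. f z)" "(LINT z|Q. B - f z) = B - (LINT z|Q. f z)"
    if "prob_space Q" "sets Q = sets borel" for Q
  proof -
    interpret prob_space Q by fact
    show "(LINT z|Q. B + f z) = B + (LINT z|Q. f z)" "(LINT z|Q. B - f z) = B - (LINT z|Q. f z)"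
      using bdd_cont_integrable[OF that f] by (simp_all add: prob_space)
  qed
  have lower: "\<forall>\<^sub>F n in sequentially. (LINT z|\<nu>. h z) - e < (LINT z|\<mu> n. h z)"
    if "bdd_cont h" "\<And>z. 0 \<le> h z" "0 < e" for h e
    by (rule eventually_integral_lower_bound[OF D \<mu> \<nu> _ that]) (rule conv)
  show ?thesis
  proof (rule tendstoI)
    fix e :: real
    assume e: "0 < e"
    show "\<forall>\<^sub>F n in sequentially. dist (LINT z|\<mu> n. f z) (LINT z|\<nu>. f z) < e"
      using lower[OF bc(1) nonneg(1) e] lower[OF bc(2) nonneg(2) e]
      by eventually_elim (simp add: shift \<mu> \<nu> dist_real_def abs_less_iff)
  qed
qed

lemma conv_in_distr_if_spike_family:
  fixes Y :: "nat \<Rightarrow> 'a \<Rightarrow> 's::metric_space"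
  assumes D: "countable D" "closure D = UNIV"
    and Q: "prob_space Q" "\<And>n. Y n \<in> measurable Q borel"
    and M': "prob_space M'" "Y' \<in> measurable M' borel"
    and conv: "\<And>g. g \<in> spike_family D \<Longrightarrow> (\<lambda>n. LINT z|Q. g (Y n z)) \<longlonglongrightarrow> (LINT z|M'. g (Y' z))"
  shows "conv_in_distr Q Y M' Y'"
proof -
  have law: "(LINT z|distr Q borel (Y n). g z) = (LINT z|Q. g (Y n z))"
    "(LINT z|distr M' borel Y'. g z) = (LINT z|M'. g (Y' z))" if "bdd_cont g" for g n
    using bdd_cont_measurable[OF that] Q(2) M'(2) by (simp_all add: integral_distr)
  have "(\<lambda>n. LINT z|distr Q borel (Y n). f z) \<longlonglongrightarrow> (LINT z|distr M' borel Y'. f z)"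
    if "bdd_cont f" for f
  proof (rule countable_convergence_determining[OF D])
    show "prob_space (distr Q borel (Y n))" "prob_space (distr M' borel Y')" for n
      using Q M' by (simp_all add: prob_space.prob_space_distr)
    show "(\<lambda>n. LINT z|distr Q borel (Y n). g z) \<longlonglongrightarrow> (LINT z|distr M' borel Y'. g z)"
      if "g \<in> spike_family D" for g
      using conv[OF that] law[OF bdd_cont_spike_family[OF that]] by simp
  qed (use that in simp_all)
  then show ?thesis
    using law by (simp add: conv_in_distr_def)
qed

section \<open>Quenched convergence\<close>

text \<open>
  A decomposition gives each equality outside a null set; the sequence \<open>Y\<close> being countable, one
  null set serves all \<open>n\<close>, as the passage to the limit requires.
\<close>

lemma AE_integral_eq_cond_exp:
  fixes Y :: "nat \<Rightarrow> 'a \<Rightarrow> 's::metric_space"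
  assumes "prob_space M" and "\<And>n. Y n \<in> measurable M borel"
    and "decomposition M F0 P" and "bdd_cont f"
  shows "AE \<omega> in M. \<forall>n. (LINT z|P \<omega>. f (Y n z)) = real_cond_exp M F0 (\<lambda>z. f (Y n z)) \<omega>"
proof -
  interpret prob_space M by fact
  have "integrable M (\<lambda>z. f (Y n z))" for n
    using bdd_cont_integrable[OF prob_space_distr[OF assms(2)[of n]] _ assms(4)]
      integrable_distr[OF assms(2)[of n], of f] by simp
  with assms(3) show ?thesis
    by (auto simp: AE_all_countable decomposition_def)
qed

theorem proposition3p13p1:
  fixes M :: "'a measure" and F0 :: "'a measure" and M' :: "'b measure"
    and Y :: "nat \<Rightarrow> 'a \<Rightarrow> 's::metric_space" and Y' :: "'b \<Rightarrow> 's"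
    and P :: "'a \<Rightarrow> 'a measure"
  assumes "prob_space M"
    and "subalgebra M F0"
    and "separable_space (euclidean :: 's topology)"
    and "\<And>n. Y n \<in> measurable M borel"
    and "prob_space M'"
    and "Y' \<in> measurable M' borel"
    and "decomposition M F0 P"
  shows "(quenched_conv M F0 Y M' Y' \<longrightarrow>
           (\<exists>\<Omega>0. \<Omega>0 \<in> sets M \<and> measure M \<Omega>0 = 1 \<and>
              (\<forall>f. bdd_cont f \<longrightarrow>
                 (\<forall>\<omega>\<in>\<Omega>0. (\<lambda>n. LINT z|P \<omega>. f (Y n z))
                               \<longlonglongrightarrow> (LINT z|M'. f (Y' z))))))
       \<and> (quenched_conv M F0 Y M' Y' \<longleftrightarrow>
           (AE \<omega> in M. conv_in_distr (P \<omega>) Y M' Y'))"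
proof -
  interpret prob_space M by fact
  obtain D :: "'s set" where D: "countable D" "closure D = UNIV"
    using assms(3) by (auto simp: separable_space_def euclidean_closure_of)
  have P: "prob_space (P \<omega>)" "Y n \<in> measurable (P \<omega>) borel" if "\<omega> \<in> space M" for \<omega> n
    using assms(4,7) that measurable_cong_sets[of "P \<omega>" M borel borel]
    by (auto simp: decomposition_def)
  note eq = AE_integral_eq_cond_exp[where Y = Y, OF assms(1,4,7)]
  have quenched_imp: "AE \<omega> in M. conv_in_distr (P \<omega>) Y M' Y'" if quenched: "quenched_conv M F0 Y M' Y'"
  proof -
    have "AE \<omega> in M. (\<lambda>n. LINT z|P \<omega>. g (Y n z)) \<longlonglongrightarrow> (LINT z|M'. g (Y' z))"
      if "g \<in> spike_family D" for g
    proof -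
      have g: "bdd_cont g"
        using that by (rule bdd_cont_spike_family)
      then have "AE \<omega> in M. (\<lambda>n. real_cond_exp M F0 (\<lambda>z. g (Y n z)) \<omega>) \<longlonglongrightarrow> (LINT z|M'. g (Y' z))"
        using quenched by (simp add: quenched_conv_def)
      with eq[OF g] show ?thesis
        by eventually_elim simp
    qed
    then have "AE \<omega> in M. \<forall>g\<in>spike_family D. (\<lambda>n. LINT z|P \<omega>. g (Y n z)) \<longlonglongrightarrow> (LINT z|M'. g (Y' z))"
      by (simp add: AE_ball_countable countable_spike_family D(1))
    with AE_space show ?thesis
    proof eventually_elim
      case (elim \<omega>)
      then show ?case
        using P by (intro conv_in_distr_if_spike_family[OF D _ _ assms(5,6)]) auto
    qed
  qed
  have imp_quenched: "quenched_conv M F0 Y M' Y'" if weak: "AE \<omega> in M. conv_in_distr (P \<omega>) Y M' Y'"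
    unfolding quenched_conv_def
  proof (intro allI impI)
    fix f :: "'s \<Rightarrow> real"
    assume f: "bdd_cont f"
    from weak eq[OF f]
    show "AE \<omega> in M. (\<lambda>n. real_cond_exp M F0 (\<lambda>z. f (Y n z)) \<omega>) \<longlonglongrightarrow> (LINT z|M'. f (Y' z))"
    proof eventually_elim
      case (elim \<omega>)
      have "(\<lambda>n. LINT z|P \<omega>. f (Y n z)) \<longlonglongrightarrow> (LINT z|M'. f (Y' z))"
        using elim(1) f by (simp add: conv_in_distr_def)
      moreover have "(\<lambda>n. LINT z|P \<omega>. f (Y n z)) = (\<lambda>n. real_cond_exp M F0 (\<lambda>z. f (Y n z)) \<omega>)"
        using elim(2) by blast
      ultimately show ?case
        by simp
    qed
  qed
  have full_set: "\<exists>\<Omega>0. \<Omega>0 \<in> sets M \<and> measure M \<Omega>0 = 1 \<and> (\<forall>\<omega>\<in>\<Omega>0. conv_in_distr (P \<omega>) Y M' Y')"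
    if weak: "AE \<omega> in M. conv_in_distr (P \<omega>) Y M' Y'"
  proof -
    obtain N where "\<And>\<omega>. \<omega> \<in> space M - N \<Longrightarrow> conv_in_distr (P \<omega>) Y M' Y'" "N \<in> null_sets M"
      using AE_E3[OF weak] by blast
    moreover from this have "measure M (space M - N) = 1"
      using prob_compl[of N] by (auto simp: null_sets_def measure_def)
    ultimately show ?thesis
      by (intro exI[of _ "space M - N"]) auto
  qed
  show ?thesis
    using quenched_imp imp_quenched full_set unfolding conv_in_distr_def by blast
qed

end
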